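(* Let $\mathbf{A}\in\mathbb{R}^{n\times d}$, $\mathbf{b}\in\mathbb{R}^n$, $p,q\ge1$, $r,s>0$ with $r\ne s$, and $\epsilon>0$. Then there is no $\epsilon$-coreset for the regularized function $\|\mathbf{A}\mathbf{x}-\mathbf{b}\|_p^r+\lambda\|\mathbf{x}\|_q^s$ whose size is smaller than the smallest size of an $\epsilon$-coreset for the unregularized function $\|\mathbf{A}\mathbf{x}-\mathbf{b}\|_p^r$.
   Context: For a vector $\mathbf{y}$, $\|\mathbf{y}\|_p=(\sum_j|y_j|^p)^{1/p}$. An $\epsilon$-coreset for the regularized function $\|\mathbf{A}\mathbf{x}-\mathbf{b}\|_p^r+\lambda\|\mathbf{x}\|_q^s$ is a pair $(\tilde{\mathbf{A}},\tilde{\mathbf{b}})$, $\tilde{\mathbf{A}}\in\mathbb{R}^{k\times d}$, $\tilde{\mathbf{b}}\in\mathbb{R}^k$, such that for all $\mathbf{x}\in\mathbb{R}^d$ and all $\lambda>0$, $$(1-\epsilon)\left(\|\mathbf{A}\mathbf{x}-\mathbf{b}\|_p^r+\lambda\|\mathbf{x}\|_q^s\right)\le\|\tilde{\mathbf{A}}\mathbf{x}-\tilde{\mathbf{b}}\|_p^r+\lambda\|\mathbf{x}\|_q^s\le(1+\epsilon)\left(\|\mathbf{A}\mathbf{x}-\mathbf{b}\|_p^r+\lambda\|\mathbf{x}\|_q^s\right).$$ An $\epsilon$-coreset for $\|\mathbf{A}\mathbf{x}-\mathbf{b}\|_p^r$ is a pair $(\tilde{\mathbf{A}},\tilde{\mathbf{b}})$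 of the same kind such that for all $\mathbf{x}\in\mathbb{R}^d$, $$(1-\epsilon)\|\mathbf{A}\mathbf{x}-\mathbf{b}\|_p^r\le\|\tilde{\mathbf{A}}\mathbf{x}-\tilde{\mathbf{b}}\|_p^r\le(1+\epsilon)\|\mathbf{A}\mathbf{x}-\mathbf{b}\|_p^r.$$ The size of a coreset is its number of rows $k$. The rows need not be sampled from those of $(\mathbf{A},\mathbf{b})$. *)

theory Defs
  imports Complex_Main "Jordan_Normal_Form.Matrix"
begin

definition lp_norm :: "real \<Rightarrow> real vec \<Rightarrow> real" where
  "lp_norm p y = (\<Sum>j<dim_vec y. \<bar>y $ j\<bar> powr p) powr (1 / p)"

definition regression_cost ::
    "real \<Rightarrow> real \<Rightarrow> real mat \<Rightarrow> real vec \<Rightarrow> real vec \<Rightarrow> real" where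
  "regression_cost p r A b x = lp_norm p (A *\<^sub>v x - b) powr r"

definition regularized_cost ::
    "real \<Rightarrow> real \<Rightarrow> real \<Rightarrow> real \<Rightarrow> real \<Rightarrow> real mat \<Rightarrow> real vec \<Rightarrow> real vec \<Rightarrow> real" where
  "regularized_cost p r q s lam A b x = regression_cost p r A b x + lam * lp_norm q x powr s"

text \<open>In both coreset predicates \<open>k\<close> is the size of the coreset \<open>(A', b')\<close>.\<close>

definition is_coreset ::
    "real \<Rightarrow> real \<Rightarrow> real \<Rightarrow> real mat \<Rightarrow> real vec \<Rightarrow> nat \<Rightarrow> real mat \<Rightarrow> real vec \<Rightarrow> bool" where
  "is_coreset \<epsilon> p r A b k A' b' \<longleftrightarrow>
     A' \<in> carrier_mat k (dim_col A) \<and> b' \<in> carrier_vec k \<and>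
     (\<forall>x \<in> carrier_vec (dim_col A).
        (1 - \<epsilon>) * regression_cost p r A b x \<le> regression_cost p r A' b' x \<and>
        regression_cost p r A' b' x \<le> (1 + \<epsilon>) * regression_cost p r A b x)"

definition is_regularized_coreset ::
    "real \<Rightarrow> real \<Rightarrow> real \<Rightarrow> real \<Rightarrow> real \<Rightarrow> real mat \<Rightarrow> real vec \<Rightarrow> nat \<Rightarrow> real mat \<Rightarrow> real vec \<Rightarrow> bool" where
  "is_regularized_coreset \<epsilon> p r q s A b k A' b' \<longleftrightarrow>
     A' \<in> carrier_mat k (dim_col A) \<and> b' \<in> carrier_vec k \<and>
     (\<forall>x \<in> carrier_vec (dim_col A). \<forall>lam > 0.
        (1 - \<epsilon>) * regularized_cost p r q s lam A b x \<le> regularized_cost p r q s lam A' b' x \<and>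
        regularized_cost p r q s lam A' b' x \<le> (1 + \<epsilon>) * regularized_cost p r q s lam A b x)"

definition min_coreset_size :: "real \<Rightarrow> real \<Rightarrow> real \<Rightarrow> real mat \<Rightarrow> real vec \<Rightarrow> nat" where
  "min_coreset_size \<epsilon> p r A b = (LEAST k. \<exists>A' b'. is_coreset \<epsilon> p r A b k A' b')"

text \<open>The minimum is attained, because \<open>(A, b)\<close> is a coreset of itself.\<close>

lemma is_coreset_self:
  assumes "A \<in> carrier_mat n d" and "b \<in> carrier_vec n" and "\<epsilon> > 0"
  shows "is_coreset \<epsilon> p r A b n A b"
proof -
  have "regression_cost p r A b x \<ge> 0" for x
    by (simp add: regression_cost_def)
  then show ?thesis
    using assms by (auto simp: is_coreset_def algebra_simps)
qed

lemma min_coreset_size_attained: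
  assumes "A \<in> carrier_mat n d" and "b \<in> carrier_vec n" and "\<epsilon> > 0"
  shows "\<exists>A' b'. is_coreset \<epsilon> p r A b (min_coreset_size \<epsilon> p r A b) A' b'"
  unfolding min_coreset_size_def
  by (rule LeastI_ex) (use is_coreset_self[OF assms] in blast)

end

(* For fixed x, letting \<lambda> tend to 0 in the two coreset inequalities shows that a regularized
   coreset is already a coreset of the unregularized function. *)
theory Submission
  imports Defs
begin

text \<open>At a fixed point x the penalty adds the same term \<lambda> N to the cost of the
  original and of the coreset. It cancels from both inequalities up to an error \<lambda> \<epsilon>
  N, which vanishes as \<lambda> tends to 0. So the very same pair, with the same k rows, is an
  unregularized coreset (\<open>is_coreset_if_is_regularized_coreset\<close>), and k cannot lie
  below the least such size.\<close>

text \<open>The limit t \<rightarrow> 0 from the right, in a form that avoids filters.\<close>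

lemma le_if_le_add_scaled:
  fixes a b c :: real
  assumes "c \<ge> 0" and "\<And>t. t > 0 \<Longrightarrow> a \<le> b + t * c"
  shows "a \<le> b"
proof (rule field_le_epsilon)
  fix e :: real assume "e > 0"
  \<comment> \<open>Dividing by c + 1 rather than c covers c = 0 and still keeps the error at most
    e.\<close>
  have "a \<le> b + e / (c + 1) * c"
    by (rule assms(2)) (use assms(1) \<open>e > 0\<close> in simp)
  also have "e / (c + 1) * c \<le> e"
    using assms(1) \<open>e > 0\<close> by (simp add: field_simps)
  finally show "a \<le> b + e" by simp
qed

lemma is_coreset_if_is_regularized_coreset:
  assumes "is_regularized_coreset \<epsilon> p r q s A b k A' b'" and "\<epsilon> \<ge> 0"
  shows "is_coreset \<epsilon> p r A b k A' b'"
  unfolding is_coreset_def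
proof (intro conjI ballI)
  show "A' \<in> carrier_mat k (dim_col A)" "b' \<in> carrier_vec k"
    using assms(1) by (simp_all add: is_regularized_coreset_def)
next
  fix x :: "real vec" assume x: "x \<in> carrier_vec (dim_col A)"
  define N where "N = lp_norm q x powr s"
  let ?f = "regression_cost p r A b x" and ?g = "regression_cost p r A' b' x"
  \<comment> \<open>\<epsilon> N is the slope of the error in both bounds: subtracting t N from each
    side leaves exactly t \<epsilon> N.\<close>
  have N: "\<epsilon> * N \<ge> 0"
    using assms(2) by (simp add: N_def)
  have bounds: "(1 - \<epsilon>) * (?f + t * N) \<le> ?g + t * N \<and> ?g + t * N \<le> (1 + \<epsilon>) * (?f + t * N)"
    if "t > 0" for t
    using assms(1) x that
    by (simp add: is_regularized_coreset_def regularized_cost_def N_def)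
  show "(1 - \<epsilon>) * ?f \<le> ?g"
  proof (rule le_if_le_add_scaled[OF N])
    show "(1 - \<epsilon>) * ?f \<le> ?g + t * (\<epsilon> * N)" if "t > 0" for t
      using bounds[OF that] by (simp add: algebra_simps)
  qed
  show "?g \<le> (1 + \<epsilon>) * ?f"
  proof (rule le_if_le_add_scaled[OF N])
    show "?g \<le> (1 + \<epsilon>) * ?f + t * (\<epsilon> * N)" if "t > 0" for t
      using bounds[OF that] by (simp add: algebra_simps)
  qed
qed

theorem corollary4p1p1:
  fixes n d :: nat and A :: "real mat" and b :: "real vec" and p q r s \<epsilon> :: real
  assumes "A \<in> carrier_mat n d" and "b \<in> carrier_vec n"
    and "p \<ge> 1" and "q \<ge> 1" and "r > 0" and "s > 0" and "r \<noteq> s" and "\<epsilon> > 0"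
  shows "\<not> (\<exists>k A' b'. is_regularized_coreset \<epsilon> p r q s A b k A' b' \<and>
                    k < min_coreset_size \<epsilon> p r A b)"
proof
  assume "\<exists>k A' b'. is_regularized_coreset \<epsilon> p r q s A b k A' b' \<and>
            k < min_coreset_size \<epsilon> p r A b"
  then obtain k A' b' where "is_regularized_coreset \<epsilon> p r q s A b k A' b'"
    and small: "k < min_coreset_size \<epsilon> p r A b"
    by blast
  then have "is_coreset \<epsilon> p r A b k A' b'"
    using is_coreset_if_is_regularized_coreset \<open>\<epsilon> > 0\<close> by simp
  then have "min_coreset_size \<epsilon> p r A b \<le> k"
    unfolding min_coreset_size_def by (intro Least_le exI)
  with small show False by simp
qed

end
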